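(* Let $\Gamma_1,\Gamma_2$ be non-empty sets of cycles such that the shortest cycle in $\Gamma_1$ has length $n\geq 6$ and the shortest cycle in $\Gamma_2$ has length $4$. Then a red-blue graph $G$ is $(\Gamma_1,\Gamma_2)$-critical if and only if its blue subgraph $G_{\mathrm{blue}}$ belongs (up to isomorphism) to $\mathcal G_1\cup\mathcal G_2\cup\mathcal G_3$, where $\mathcal G_1,\mathcal G_2,\mathcal G_3$ are the sets of graphs on $n$ vertices defined in the context.
   Context: All graphs are finite, simple and undirected. A red-blue graph is a complete graph with each edge coloured red or blue; its blue subgraph $G_{\mathrm{blue}}$ is the uncoloured graph with vertex set $V(G)$ whose edges are the blue edges. $R(\Gamma_1,\Gamma_2)$ is the least positive integer $N$ such that each red-blue graph on $N$ vertices contains a red subgraph from $\Gamma_1$ or a blue subgraph from $\Gamma_2$. A red-blue graph is $(\Gamma_1,\Gamma_2)$-avoiding if it contains neither a red subgraph from $\Gamma_1$ nor a blue subgraph from $\Gamma_2$; it is $(\Gamma_1,\Gamma_2)$-critical if moreover it has $R(\Gamma_1,\Gamma_2)-1$ vertices. $N(u)$ and $d(u)$ denote the set and the number of neighbours of a vertex $u$. A graph $H$ has a matching on $U\subseteq V(H)$ if each vertex in $U$ has degree at most $1$ in the induced subgraph $H[U]$. For $n\geq 6$, the sets $\mathcal G_i$ consist of graphs on the $n$-element vertex set $\{v\}\cup X\cup\{y\}$ with $X=\{x_1,\ldots,x_{n-2}\}$, as follows: - $\mathcal G_1$: the graphs with $N(v)=X$, having a matching on $X\cup\{y\}$; - $\mathcal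 G_2$: the graphs with $N(v)=X$, $N(y)=\{x_{n-2}\}$ and $d(x_{n-2})=3$, having a matching on $X$; - $\mathcal G_3$: the graphs with $N(v)=X\cup\{y\}$, having a matching on $X\cup\{y\}$. *)

theory Defs
  imports Main
begin

record 'a graph =
  verts :: "'a set"
  edges :: "'a set set"

definition simple_graph :: "('a, 'm) graph_scheme \<Rightarrow> bool" where
  "simple_graph G \<longleftrightarrow> finite (verts G) \<and> (\<forall>e\<in>edges G. e \<subseteq> verts G \<and> card e = 2)"

definition complete_graph :: "('a, 'm) graph_scheme \<Rightarrow> bool" where
  "complete_graph G \<longleftrightarrow>
     simple_graph G \<and> (\<forall>u\<in>verts G. \<forall>w\<in>verts G. u \<noteq> w \<longrightarrow> {u, w} \<in> edges G)"

definition subgraph :: "'a graph \<Rightarrow> 'a graph \<Rightarrow> bool" where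
  "subgraph H G \<longleftrightarrow> simple_graph H \<and> verts H \<subseteq> verts G \<and> edges H \<subseteq> edges G"

definition induced_subgraph :: "'a graph \<Rightarrow> 'a set \<Rightarrow> 'a graph" where
  "induced_subgraph G U = \<lparr>verts = U, edges = {e \<in> edges G. e \<subseteq> U}\<rparr>"

definition isomorphic :: "'a graph \<Rightarrow> 'b graph \<Rightarrow> bool" where
  "isomorphic G H \<longleftrightarrow>
     (\<exists>f. bij_betw f (verts G) (verts H) \<and> (\<lambda>e. f ` e) ` edges G = edges H)"

definition nbrs :: "'a graph \<Rightarrow> 'a \<Rightarrow> 'a set" where
  "nbrs G u = {w \<in> verts G. {u, w} \<in> edges G}"

definition degree :: "'a graph \<Rightarrow> 'a \<Rightarrow> nat" where
  "degree G u = card (nbrs G u)"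

definition has_matching_on :: "'a graph \<Rightarrow> 'a set \<Rightarrow> bool" where
  "has_matching_on H U \<longleftrightarrow>
     U \<subseteq> verts H \<and> (\<forall>u\<in>U. degree (induced_subgraph H U) u \<le> 1)"

definition is_cycle :: "'a graph \<Rightarrow> bool" where
  "is_cycle C \<longleftrightarrow>
     (\<exists>vs. distinct vs \<and> length vs \<ge> 3 \<and> verts C = set vs \<and>
           edges C = {{vs ! i, vs ! (Suc i mod length vs)} | i. i < length vs})"

definition cycle_length :: "'a graph \<Rightarrow> nat" where
  "cycle_length C = card (edges C)"

text \<open>Only meaningful for a non-empty set of cycles.\<close>
definition shortest_cycle_length :: "'a graph set \<Rightarrow> nat" where
  "shortest_cycle_length \<Gamma> = (LEAST k. \<exists>C\<in>\<Gamma>. cycle_length C = k)"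


datatype colour = Red | Blue

text \<open>The values of \<open>colour\<close> on sets that are not edges are irrelevant.\<close>
record 'a rb_graph = "'a graph" +
  colour :: "'a set \<Rightarrow> colour"

definition red_blue_graph :: "'a rb_graph \<Rightarrow> bool" where
  "red_blue_graph G \<longleftrightarrow> complete_graph G"

definition red_subgraph :: "'a rb_graph \<Rightarrow> 'a graph" where
  "red_subgraph G = \<lparr>verts = verts G, edges = {e \<in> edges G. colour G e = Red}\<rparr>"

definition blue_subgraph :: "'a rb_graph \<Rightarrow> 'a graph" where
  "blue_subgraph G = \<lparr>verts = verts G, edges = {e \<in> edges G. colour G e = Blue}\<rparr>"

text \<open>As usual, a graph contains a subgraph from \<open>\<Gamma>\<close> if some subgraph is isomorphic to a
  member of \<open>\<Gamma>\<close>; the members of \<open>\<Gamma>\<close> may live on a different vertex type.\<close>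
definition contains_from :: "'a graph \<Rightarrow> 'b graph set \<Rightarrow> bool" where
  "contains_from G \<Gamma> \<longleftrightarrow> (\<exists>H. subgraph H G \<and> (\<exists>C\<in>\<Gamma>. isomorphic H C))"

definition avoiding :: "'b graph set \<Rightarrow> 'c graph set \<Rightarrow> 'a rb_graph \<Rightarrow> bool" where
  "avoiding \<Gamma>1 \<Gamma>2 G \<longleftrightarrow>
     red_blue_graph G \<and>
     \<not> contains_from (red_subgraph G) \<Gamma>1 \<and> \<not> contains_from (blue_subgraph G) \<Gamma>2"

text \<open>Taking the vertices from \<open>nat\<close> is no restriction, since every finite graph is isomorphic
  to one with vertices in \<open>nat\<close>.\<close>
definition ramsey_number :: "'b graph set \<Rightarrow> 'c graph set \<Rightarrow> nat" where
  "ramsey_number \<Gamma>1 \<Gamma>2 =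
     (LEAST N. N > 0 \<and>
        (\<forall>G :: nat rb_graph. red_blue_graph G \<and> card (verts G) = N \<longrightarrow>
           contains_from (red_subgraph G) \<Gamma>1 \<or> contains_from (blue_subgraph G) \<Gamma>2))"

definition critical :: "'b graph set \<Rightarrow> 'c graph set \<Rightarrow> 'a rb_graph \<Rightarrow> bool" where
  "critical \<Gamma>1 \<Gamma>2 G \<longleftrightarrow>
     avoiding \<Gamma>1 \<Gamma>2 G \<and> card (verts G) = ramsey_number \<Gamma>1 \<Gamma>2 - 1"


datatype gvertex = vert_v | vert_x nat | vert_y

definition X_set :: "nat \<Rightarrow> gvertex set" where
  "X_set n = vert_x ` {1..n - 2}"

definition graphs_on :: "nat \<Rightarrow> gvertex graph set" where
  "graphs_on n = {H. simple_graph H \<and> verts H = {vert_v} \<union> X_set n \<union> {vert_y}}"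

definition \<G>1 :: "nat \<Rightarrow> gvertex graph set" where
  "\<G>1 n = {H \<in> graphs_on n.
     nbrs H vert_v = X_set n \<and> has_matching_on H (X_set n \<union> {vert_y})}"

definition \<G>2 :: "nat \<Rightarrow> gvertex graph set" where
  "\<G>2 n = {H \<in> graphs_on n.
     nbrs H vert_v = X_set n \<and> nbrs H vert_y = {vert_x (n - 2)} \<and>
     degree H (vert_x (n - 2)) = 3 \<and> has_matching_on H (X_set n)}"

definition \<G>3 :: "nat \<Rightarrow> gvertex graph set" where
  "\<G>3 n = {H \<in> graphs_on n.
     nbrs H vert_v = X_set n \<union> {vert_y} \<and> has_matching_on H (X_set n \<union> {vert_y})}"

end

theory Submission
  imports Defs
begin

text \<open>
  Let \<open>G\<close> have \<open>n \<ge> 6\<close> vertices and a blue subgraph without 4-cycles. If every vertex has red degree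
  at least 2, then there is a red Hamiltonian cycle, by induction on \<open>n\<close>. A vertex \<open>w\<close> with three red
  neighbours on a red cycle through all other vertices can be inserted into that cycle, for otherwise
  \<open>w\<close> and the successors of these neighbours form a blue \<open>K\<^sub>4\<close>. For \<open>n \<ge> 7\<close> at most two vertices have
  red degree 2, as blue neighbourhoods of size \<open>n - 3\<close> meet pairwise in at most one vertex, and two
  such vertices have a common blue neighbour; removing it (or any blue neighbour of the only such
  vertex) keeps all red degrees at least 2.

  Hence a graph on \<open>n\<close> vertices is avoiding iff its blue subgraph has no 4-cycle and a vertex of degree
  at least \<open>n - 2\<close>, and these are exactly the graphs in \<open>\<G>1 n \<union> \<G>2 n \<union> \<G>3 n\<close>. An avoiding
  graph on \<open>n + 1\<close> vertices would have two vertices of blue degree at least \<open>n - 2\<close>, and these would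
  have two common blue neighbours; so the Ramsey number is \<open>n + 1\<close>.
\<close>

section \<open>Hamiltonian cycles in complements of 4-cycle-free graphs\<close>

text \<open>Lists of length one or two are not ruled out, so a genuine cycle needs a separate bound
  on the length, as in \<open>closed_path_imp_red_cycle\<close>.\<close>

definition closed_path :: "('a \<Rightarrow> 'a \<Rightarrow> bool) \<Rightarrow> 'a list \<Rightarrow> bool" where
  "closed_path R cs \<longleftrightarrow> cs \<noteq> [] \<and> distinct cs \<and> successively R cs \<and> R (last cs) (hd cs)"

lemma closed_path_rotate: "closed_path R (xs @ ys) \<Longrightarrow> closed_path R (ys @ xs)"
  by (cases "xs = []"; cases "ys = []") (auto simp: closed_path_def successively_append_iff)

text \<open>If \<open>w\<close> is joined to \<open>hd xs\<close>, it fits between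
  \<open>last ys\<close> and \<open>hd xs\<close>. Otherwise the chord from \<open>hd xs\<close> to
  \<open>hd ys\<close> is available: run from \<open>w\<close> to \<open>last ys\<close>, back
  through \<open>ys\<close> to \<open>hd ys\<close>, across the chord, along \<open>xs\<close> and
  from \<open>last xs\<close> to \<open>w\<close>.\<close>

lemma closed_path_insert:
  assumes R: "symp R"
    and "closed_path R (xs @ ys)" "xs \<noteq> []" "ys \<noteq> []" "w \<notin> set (xs @ ys)"
    and "R w (last xs)" "R w (last ys)" "R w (hd xs) \<or> R (hd xs) (hd ys)"
  shows "\<exists>cs. closed_path R cs \<and> set cs = insert w (set (xs @ ys))"
proof (cases "R w (hd xs)")
  case True
  then have "closed_path R (w # xs @ ys)"
    using assms by (auto simp: closed_path_def successively_Cons dest: sympD)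
  then show ?thesis by (intro exI[of _ "w # xs @ ys"]) simp
next
  case False
  then have "R (hd ys) (hd xs)" using assms by (auto dest: sympD)
  moreover have "successively R (rev ys)"
    using assms(2) R by (auto simp: closed_path_def successively_append_iff intro: successively_mono dest: sympD)
  ultimately have "closed_path R (w # rev ys @ xs)"
    using assms by (auto simp: closed_path_def successively_Cons successively_append_iff last_rev hd_rev dest: sympD)
  then show ?thesis by (intro exI[of _ "w # rev ys @ xs"]) auto
qed

text \<open>Rotate the cycle so that it ends in \<open>p\<close>, then cut after each of the three
  vertices. The heads of the segments are their successors on the cycle. The cyclic order of
  \<open>q\<close> and \<open>r\<close> is unknown, so the last entries are only given as a
  set.\<close>

lemma closed_path_split3:
  assumes "closed_path R cs" "p \<in> set cs" "q \<in> set cs" "r \<in> set cs" "distinct [p, q, r]"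
  obtains xs ys zs where "closed_path R (xs @ ys @ zs)" "set (xs @ ys @ zs) = set cs"
    "xs \<noteq> []" "ys \<noteq> []" "zs \<noteq> []" "{last xs, last ys, last zs} = {p, q, r}"
proof -
  obtain as bs where cs: "cs = as @ p # bs" using assms(2) by (meson split_list)
  have closed_path: "closed_path R ((bs @ as) @ [p])"
    using closed_path_rotate[of R "as @ [p]" bs] assms(1) cs by simp
  have in_rest: "q \<in> set (bs @ as)" "r \<in> set (bs @ as)" using assms(3-5) cs by auto
  then obtain cs' ds where eq: "bs @ as = cs' @ q # ds" by (meson split_list)
  have set_eq: "set cs = insert p (set (bs @ as))" using cs by auto
  show thesis
  proof (cases "r \<in> set ds")
    case True
    then obtain es fs where "ds = es @ r # fs" by (meson split_list)
    then show thesis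
      using that[of "cs' @ [q]" "es @ [r]" "fs @ [p]"] closed_path set_eq eq by auto
  next
    case False
    then have "r \<in> set cs'" using in_rest eq assms(5) by auto
    then obtain es fs where "cs' = es @ r # fs" by (meson split_list)
    then show thesis
      using that[of "es @ [r]" "fs @ [q]" "ds @ [p]"] closed_path set_eq eq by auto
  qed
qed

text \<open>Adjacent vertices differ by \<open>irrefl\<close>, so a closed walk of length 4
  degenerates only through \<open>a = c\<close> or \<open>b = d\<close>; \<open>no_C4\<close> thus
  excludes exactly the 4-cycles on distinct vertices.\<close>

locale C4_free =
  fixes B :: "'a \<Rightarrow> 'a \<Rightarrow> bool"
  assumes sym: "B u v \<Longrightarrow> B v u"
    and irrefl: "\<not> B u u"
    and no_C4: "B a b \<Longrightarrow> B b c \<Longrightarrow> B c d \<Longrightarrow> B d a \<Longrightarrow> a = c \<or> b = d"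
begin

abbreviation R :: "'a \<Rightarrow> 'a \<Rightarrow> bool" where "R u v \<equiv> \<not> B u v"

lemma symp_R: "symp R" by (auto intro: sympI dest: sym)

lemma closed_path_insert_vertex:
  assumes "closed_path R cs" "w \<notin> set cs" "3 \<le> card {u \<in> set cs. R w u}"
  shows "\<exists>cs'. closed_path R cs' \<and> set cs' = insert w (set cs)"
proof -
  obtain T where T: "T \<subseteq> {u \<in> set cs. R w u}" "card T = 3"
    using assms(3) by (meson obtain_subset_with_card_n)
  then obtain p q r where pqr: "T = {p, q, r}" "distinct [p, q, r]"
    by (auto simp: card_3_iff)
  obtain xs ys zs where closed_path: "closed_path R (xs @ ys @ zs)" and set_eq: "set (xs @ ys @ zs) = set cs"
    and ne: "xs \<noteq> []" "ys \<noteq> []" "zs \<noteq> []" and last: "{last xs, last ys, last zs} = {p, q, r}"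
    using closed_path_split3[OF assms(1), of p q r] T pqr by auto
  have "R w (last xs)" "R w (last ys)" "R w (last zs)" using last T pqr by blast+
  note red = this
  have rotated: "closed_path R (ys @ zs @ xs)" "closed_path R (zs @ xs @ ys)"
    using closed_path_rotate[of R xs "ys @ zs"] closed_path_rotate[of R "xs @ ys" zs] closed_path by simp_all
  show ?thesis
  proof (rule ccontr)
    assume no: "\<nexists>cs'. closed_path R cs' \<and> set cs' = insert w (set cs)"
    \<comment> \<open>Each rotation of the three segments is a failed insertion. Together they make
      \<open>w\<close> and the three heads a blue complete graph; its two diagonals show that the
      4-cycle through these vertices is not degenerate.\<close>
    have "B w (hd xs) \<and> B (hd xs) (hd ys)"
      using closed_path_insert[OF symp_R, of xs "ys @ zs" w] no closed_path set_eq ne red assms(2) by auto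
    moreover have "B w (hd ys) \<and> B (hd ys) (hd zs)"
      using closed_path_insert[OF symp_R, of ys "zs @ xs" w] no rotated set_eq ne red assms(2) by auto
    moreover have "B w (hd zs) \<and> B (hd zs) (hd xs)"
      using closed_path_insert[OF symp_R, of zs "xs @ ys" w] no rotated set_eq ne red assms(2) by auto
    ultimately show False using no_C4[of w "hd xs" "hd ys" "hd zs"] by (metis sym irrefl)
  qed
qed

text \<open>Two common neighbours of \<open>u\<close> and \<open>v\<close> would close a
  4-cycle.\<close>

lemma card_common_le_1:
  assumes "finite V" "u \<noteq> v"
  shows "card ({x \<in> V. B u x} \<inter> {x \<in> V. B v x}) \<le> 1"
proof -
  have "x = y" if "B u x" "B v x" "B u y" "B v y" for x y
    using no_C4[of u x v y] that assms(2) by (metis sym)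
  then show ?thesis using assms(1) by (auto simp: card_le_Suc0_iff_eq)
qed

text \<open>Base case of the induction, settled by propositional refutation. Five vertices would be
  too few: a blue triangle and a disjoint blue edge leave a red complete bipartite graph with parts
  of sizes 3 and 2.\<close>

lemma hamiltonian_6:
  assumes "card V = 6" "\<forall>v\<in>V. card {u \<in> V. B v u} \<le> 3"
  shows "\<exists>cs. closed_path R cs \<and> set cs = V"
proof (rule ccontr)
  assume no: "\<nexists>cs. closed_path R cs \<and> set cs = V"
  have fin: "finite V" using assms(1) by (intro card_ge_0_finite) simp
  then obtain vs where "distinct vs" "set vs = V" using finite_distinct_list by blast
  moreover from this have "length vs = 6" using assms(1) distinct_card by metis
  ultimately obtain a b c d e f where vs: "distinct [a, b, c, d, e, f]" and V: "V = {a, b, c, d, e, f}"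
    by (auto simp: numeral_eq_Suc length_Suc_conv)
  have deg: "\<not> (B p q \<and> B p r \<and> B p s \<and> B p t)"
    if "distinct [p, q, r, s, t]" "{p, q, r, s, t} \<subseteq> V" for p q r s t
  proof
    assume "B p q \<and> B p r \<and> B p s \<and> B p t"
    then have "{q, r, s, t} \<subseteq> {u \<in> V. B p u}" using that by auto
    then have "card {q, r, s, t} \<le> 3"
      using assms(2) that(2) fin card_mono[of "{u \<in> V. B p u}" "{q, r, s, t}"] by fastforce
    then show False using that(1) by simp
  qed
  have ham: "B a p \<or> B p q \<or> B q r \<or> B r s \<or> B s t \<or> B t a"
    if "distinct [a, p, q, r, s, t]" "{p, q, r, s, t} \<subseteq> V" for p q r s t
  proof (rule ccontr)
    assume "\<not> ?thesis"
    then have "closed_path R [a, p, q, r, s, t]" using that(1) by (simp add: closed_path_def)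
    moreover have "set [a, p, q, r, s, t] = V"
      using that vs V fin by (intro card_subset_eq) (auto simp: assms(1))
    ultimately show False using no by blast
  qed
  have ne: "a \<noteq> b" "a \<noteq> c" "a \<noteq> d" "a \<noteq> e" "a \<noteq> f" "b \<noteq> c" "b \<noteq> d" "b \<noteq> e" "b \<noteq> f"
    "c \<noteq> d" "c \<noteq> e" "c \<noteq> f" "d \<noteq> e" "d \<noteq> f" "e \<noteq> f" using vs by auto
  have commute: "B b a = B a b" "B c a = B a c" "B d a = B a d" "B e a = B a e" "B f a = B a f"
    "B c b = B b c" "B d b = B b d" "B e b = B b e" "B f b = B b f" "B d c = B c d"
    "B e c = B c e" "B f c = B c f" "B e d = B d e" "B f d = B d f" "B f e = B e f"
    using sym by blast+
  \<comment> \<open>Orienting every edge alphabetically collapses the 30 ordered pairs into 15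
    propositional variables.\<close>
  note [simp] = ne ne[THEN not_sym] commute
  \<comment> \<open>The 60 Hamiltonian cycles, 45 four-cycles and 30 four-stars of the complete graph on
    \<open>V\<close> give an unsatisfiable propositional problem in the 15 edges.\<close>
  note clauses =
    ham[of b c d e f] ham[of b c d f e] ham[of b c e d f] ham[of b c e f d]
    ham[of b c f d e] ham[of b c f e d] ham[of b d c e f] ham[of b d c f e]
    ham[of b d e c f] ham[of b d e f c] ham[of b d f c e] ham[of b d f e c]
    ham[of b e c d f] ham[of b e c f d] ham[of b e d c f] ham[of b e d f c]
    ham[of b e f c d] ham[of b e f d c] ham[of b f c d e] ham[of b f c e d]
    ham[of b f d c e] ham[of b f d e c] ham[of b f e c d] ham[of b f e d c]
    ham[of c b d e f] ham[of c b d f e] ham[of c b e d f] ham[of c b e f d]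
    ham[of c b f d e] ham[of c b f e d] ham[of c d b e f] ham[of c d b f e]
    ham[of c d e b f] ham[of c d f b e] ham[of c e b d f] ham[of c e b f d]
    ham[of c e d b f] ham[of c e f b d] ham[of c f b d e] ham[of c f b e d]
    ham[of c f d b e] ham[of c f e b d] ham[of d b c e f] ham[of d b c f e]
    ham[of d b e c f] ham[of d b f c e] ham[of d c b e f] ham[of d c b f e]
    ham[of d c e b f] ham[of d c f b e] ham[of d e b c f] ham[of d e c b f]
    ham[of d f b c e] ham[of d f c b e] ham[of e b c d f] ham[of e b d c f]
    ham[of e c b d f] ham[of e c d b f] ham[of e d b c f] ham[of e d c b f]
    no_C4[of a b c d] no_C4[of a b d c] no_C4[of a c b d] no_C4[of a b c e]
    no_C4[of a b e c] no_C4[of a c b e] no_C4[of a b c f] no_C4[of a b f c]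
    no_C4[of a c b f] no_C4[of a b d e] no_C4[of a b e d] no_C4[of a d b e]
    no_C4[of a b d f] no_C4[of a b f d] no_C4[of a d b f] no_C4[of a b e f]
    no_C4[of a b f e] no_C4[of a e b f] no_C4[of a c d e] no_C4[of a c e d]
    no_C4[of a d c e] no_C4[of a c d f] no_C4[of a c f d] no_C4[of a d c f]
    no_C4[of a c e f] no_C4[of a c f e] no_C4[of a e c f] no_C4[of a d e f]
    no_C4[of a d f e] no_C4[of a e d f] no_C4[of b c d e] no_C4[of b c e d]
    no_C4[of b d c e] no_C4[of b c d f] no_C4[of b c f d] no_C4[of b d c f]
    no_C4[of b c e f] no_C4[of b c f e] no_C4[of b e c f] no_C4[of b d e f]
    no_C4[of b d f e] no_C4[of b e d f] no_C4[of c d e f] no_C4[of c d f e]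
    no_C4[of c e d f]
    deg[of a b c d e] deg[of a b c d f] deg[of a b c e f] deg[of a b d e f]
    deg[of a c d e f] deg[of b a c d e] deg[of b a c d f] deg[of b a c e f]
    deg[of b a d e f] deg[of b c d e f] deg[of c a b d e] deg[of c a b d f]
    deg[of c a b e f] deg[of c a d e f] deg[of c b d e f] deg[of d a b c e]
    deg[of d a b c f] deg[of d a b e f] deg[of d a c e f] deg[of d b c e f]
    deg[of e a b c d] deg[of e a b c f] deg[of e a b d f] deg[of e a c d f]
    deg[of e b c d f] deg[of f a b c d] deg[of f a b c e] deg[of f a b d e]
    deg[of f a c d e] deg[of f b c d e]
  show False using clauses[unfolded V, simplified] by sat
qed

lemma hamiltonian_complement:
  assumes "6 \<le> n" "card V = n" "\<forall>v\<in>V. card {u \<in> V. B v u} + 3 \<le> n"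
  shows "\<exists>cs. closed_path R cs \<and> set cs = V"
  using assms
proof (induction n arbitrary: V rule: nat_induct_at_least)
  case base
  then show ?case by (intro hamiltonian_6) auto
next
  case (Suc n)
  let ?N = "\<lambda>v. {u \<in> V. B v u}"
  have fin: "finite V" using Suc.prems(1) by (intro card_ge_0_finite) simp
  \<comment> \<open>Now \<open>V\<close> has n + 1 vertices, so \<open>S\<close> collects those of
    red degree exactly 2. Deleting \<open>w\<close> preserves the degree hypothesis if
    \<open>w\<close> is blue to all of \<open>S\<close>, and \<open>w\<close> outside
    \<open>S\<close> guarantees the three red neighbours needed to insert it again.\<close>
  define S where "S = {v \<in> V. card (?N v) = n - 2}"
  have finS: "finite S" using fin by (simp add: S_def)
  have le: "card A \<le> n + 1" if "A \<subseteq> V" for A using card_mono[OF fin that] Suc.prems(1) by simp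
  have two: "2 * (n - 2) - card (?N u \<inter> ?N v) = card (?N u \<union> ?N v)"
    if "u \<in> S" "v \<in> S" for u v
    using card_Un_Int[of "?N u" "?N v"] that fin by (simp add: S_def)
  have "\<exists>w\<in>V - S. \<forall>u\<in>S. B u w"
  proof (cases "card S \<le> 1")
    case True
    show ?thesis
    proof (cases "S = {}")
      case True
      then show ?thesis using Suc.prems(1) by (metis Diff_empty card.empty empty_iff ex_in_conv nat.distinct(1))
    next
      case False
      then obtain u where u: "S = {u}" using \<open>card S \<le> 1\<close> finS
        by (metis card_1_singletonE card_0_eq le_less less_one)
      then have "card (?N u) > 0" using Suc.hyps by (auto simp: S_def)
      then obtain w where "w \<in> ?N u" by (metis card_gt_0_iff ex_in_conv)
      then show ?thesis using u irrefl by blast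
    qed
  next
    case False
    then obtain u v where uv: "u \<in> S" "v \<in> S" "u \<noteq> v"
      using finS by (auto simp: card_le_Suc0_iff_eq)
    \<comment> \<open>A third such vertex would give three sets of size n - 2 meeting pairwise in at
      most one vertex. Their union has at least 3n - 9 elements, more than the n + 1
      available.\<close>
    have "x = u \<or> x = v" if x: "x \<in> S" for x
    proof (rule ccontr)
      assume ne: "\<not> (x = u \<or> x = v)"
      have "card ((?N u \<union> ?N v) \<inter> ?N x) \<le> card (?N u \<inter> ?N x) + card (?N v \<inter> ?N x)"
        unfolding Int_Un_distrib2 by (rule card_Un_le)
      also have "\<dots> \<le> 2"
        using card_common_le_1[OF fin, of u x] card_common_le_1[OF fin, of v x] ne by auto
      finally have "card ((?N u \<union> ?N v) \<inter> ?N x) \<le> 2" .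
      moreover have "card (?N u \<union> ?N v) \<ge> 2 * (n - 2) - 1"
        using two[OF uv(1,2)] card_common_le_1[OF fin uv(3)] by simp
      moreover have "card (?N u \<union> ?N v) + card (?N x) =
          card (?N u \<union> ?N v \<union> ?N x) + card ((?N u \<union> ?N v) \<inter> ?N x)"
        using fin by (intro card_Un_Int) auto
      moreover have "card (?N u \<union> ?N v \<union> ?N x) \<le> n + 1" by (intro le) auto
      moreover have "card (?N x) = n - 2" using x by (simp add: S_def)
      ultimately show False using Suc.hyps by linarith
    qed
    then have S: "S = {u, v}" using uv by auto
    \<comment> \<open>Disjoint neighbourhoods would occupy 2n - 4 > n + 1 vertices.\<close>
    have "card (?N u \<inter> ?N v) \<noteq> 0"
      using two[OF uv(1,2)] le[of "?N u \<union> ?N v"] Suc.hyps by auto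
    then obtain w where "w \<in> ?N u \<inter> ?N v" by (metis card.empty ex_in_conv)
    then show ?thesis using S irrefl by blast
  qed
  then obtain w where w: "w \<in> V" "w \<notin> S" "\<And>u. u \<in> S \<Longrightarrow> B u w" by blast
  have small: "card (?N v) + 3 \<le> n" if "v \<in> V" "v \<notin> S" for v
    using Suc.prems(2) Suc.hyps that by (force simp: S_def)
  have "\<exists>cs. closed_path R cs \<and> set cs = V - {w}"
  proof (rule Suc.IH)
    show "card (V - {w}) = n" using w Suc.prems(1) by simp
    show "\<forall>v\<in>V - {w}. card {u \<in> V - {w}. B v u} + 3 \<le> n"
    proof
      fix v assume v: "v \<in> V - {w}"
      have eq: "{u \<in> V - {w}. B v u} = ?N v - {w}" by auto
      show "card {u \<in> V - {w}. B v u} + 3 \<le> n"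
      proof (cases "v \<in> S")
        case True
        then have "card (?N v - {w}) = n - 3" using w by (simp add: S_def)
        then show ?thesis using eq Suc.hyps by simp
      next
        case False
        have "card (?N v - {w}) \<le> card (?N v)" using fin by (intro card_mono) auto
        then show ?thesis using small[of v] v False eq by simp
      qed
    qed
  qed
  then obtain cs where cs: "closed_path R cs" "set cs = V - {w}" by blast
  have "{u \<in> set cs. R w u} = (V - {w}) - ?N w" using cs by auto
  moreover have "card ((V - {w}) - ?N w) \<ge> card (V - {w}) - card (?N w)"
    using fin by (intro diff_card_le_card_Diff) auto
  ultimately have "3 \<le> card {u \<in> set cs. R w u}"
    using small[OF w(1,2)] w(1) Suc.prems(1) by simp
  then show ?case using closed_path_insert_vertex[OF cs(1), of w] cs(2) w(1) by auto
qed

end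

section \<open>Cycles as subgraphs\<close>

text \<open>An isomorphism-free form of containing a cycle of length \<open>k\<close>; by
  \<open>contains_from_iff\<close> a family of cycles matters only through its lengths.\<close>

definition has_cycle :: "'a graph \<Rightarrow> nat \<Rightarrow> bool" where
  "has_cycle G k \<longleftrightarrow> (\<exists>vs. distinct vs \<and> length vs = k \<and> 3 \<le> k \<and>
     (\<forall>i<k. {vs ! i, vs ! (Suc i mod k)} \<in> edges G))"

lemma simple_graph_edgeD:
  assumes "simple_graph G" "{u, w} \<in> edges G"
  shows "u \<in> verts G" "w \<in> verts G" "u \<noteq> w"
  using assms by (fastforce simp: simple_graph_def)+

text \<open>\<open>cycle_length\<close> counts edges, while the arguments count vertices. Edges at
  different positions \<open>i\<close> and \<open>j\<close> could coincide only if each index were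
  the cyclic successor of the other, impossible for length at least 3.\<close>

lemma card_cycle_edges:
  assumes "distinct vs" "3 \<le> length vs"
  shows "card {{vs ! i, vs ! (Suc i mod length vs)} | i. i < length vs} = length vs"
proof -
  let ?k = "length vs"
  have "inj_on (\<lambda>i. {vs ! i, vs ! (Suc i mod ?k)}) {..<?k}"
  proof (rule inj_onI)
    fix i j assume ij: "i \<in> {..<?k}" "j \<in> {..<?k}"
      and "{vs ! i, vs ! (Suc i mod ?k)} = {vs ! j, vs ! (Suc j mod ?k)}"
    moreover have "Suc i mod ?k < ?k" "Suc j mod ?k < ?k" using assms(2) by (auto intro: mod_less_divisor)
    ultimately have "i = j \<or> (i = Suc j mod ?k \<and> Suc i mod ?k = j)"
      using assms(1) by (auto simp: doubleton_eq_iff nth_eq_iff_index_eq)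
    then show "i = j" using assms(2) ij by (auto simp: mod_Suc split: if_splits)
  qed
  then have "card ((\<lambda>i. {vs ! i, vs ! (Suc i mod ?k)}) ` {..<?k}) = ?k"
    by (simp add: card_image)
  moreover have "(\<lambda>i. {vs ! i, vs ! (Suc i mod ?k)}) ` {..<?k} =
      {{vs ! i, vs ! (Suc i mod ?k)} | i. i < ?k}" by auto
  ultimately show ?thesis by simp
qed

text \<open>A copy of a member is pulled back along the inverse of the isomorphism. Conversely,
  matching the two vertex lists position by position gives the isomorphism.\<close>

lemma contains_from_iff:
  assumes "simple_graph G" "\<forall>C\<in>\<Gamma>. is_cycle C"
  shows "contains_from G \<Gamma> \<longleftrightarrow> (\<exists>C\<in>\<Gamma>. has_cycle G (cycle_length C))"
proof
  assume "contains_from G \<Gamma>"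
  then obtain H C where H: "subgraph H G" and C: "C \<in> \<Gamma>" and "isomorphic H C"
    by (auto simp: contains_from_def)
  then obtain f where f: "bij_betw f (verts H) (verts C)" and E: "(`) f ` edges H = edges C"
    by (auto simp: isomorphic_def)
  obtain vs where vs: "distinct vs" "3 \<le> length vs" "verts C = set vs"
    and EC: "edges C = {{vs ! i, vs ! (Suc i mod length vs)} | i. i < length vs}"
    using assms(2) C by (auto simp: is_cycle_def)
  define g where "g = inv_into (verts H) f"
  have g: "bij_betw g (set vs) (verts H)"
    using f vs(3) by (simp add: g_def bij_betw_inv_into)
  have "has_cycle G (length vs)"
    unfolding has_cycle_def
  proof (intro exI[of _ "map g vs"] conjI allI impI)
    show "distinct (map g vs)" using vs g by (simp add: distinct_map bij_betw_def)
    fix i assume i: "i < length vs"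
    then have "Suc i mod length vs < length vs" by (intro mod_less_divisor) auto
    moreover have "{vs ! i, vs ! (Suc i mod length vs)} \<in> edges C" using EC i by blast
    then obtain e where e: "e \<in> edges H" "f ` e = {vs ! i, vs ! (Suc i mod length vs)}"
      using E by (metis imageE)
    have "e \<subseteq> verts H" using H e(1) by (auto simp: subgraph_def simple_graph_def)
    then have "g ` f ` e = e" using f by (simp add: g_def bij_betw_def inv_into_image_cancel)
    then have "{g (vs ! i), g (vs ! (Suc i mod length vs))} = e" using e by simp
    ultimately show "{map g vs ! i, map g vs ! (Suc i mod length vs)} \<in> edges G"
      using i e(1) H by (auto simp: subgraph_def)
  qed (use vs in auto)
  moreover have "cycle_length C = length vs"
    using card_cycle_edges[OF vs(1,2)] EC by (simp add: cycle_length_def)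
  ultimately show "\<exists>C\<in>\<Gamma>. has_cycle G (cycle_length C)" using C by metis
next
  assume "\<exists>C\<in>\<Gamma>. has_cycle G (cycle_length C)"
  then obtain C where C: "C \<in> \<Gamma>" "has_cycle G (cycle_length C)" by blast
  obtain vs where vs: "distinct vs" "3 \<le> length vs" "verts C = set vs"
    and EC: "edges C = {{vs ! i, vs ! (Suc i mod length vs)} | i. i < length vs}"
    using assms(2) C(1) by (auto simp: is_cycle_def)
  let ?k = "length vs"
  have "cycle_length C = ?k"
    using card_cycle_edges[OF vs(1,2)] EC by (simp add: cycle_length_def)
  then obtain ws where ws: "distinct ws" "length ws = ?k"
    and EG: "\<And>i. i < ?k \<Longrightarrow> {ws ! i, ws ! (Suc i mod ?k)} \<in> edges G"
    using C(2) by (auto simp: has_cycle_def)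
  have mod_k: "Suc i mod ?k < ?k" for i using vs(2) by (intro mod_less_divisor) auto
  define H where "H = \<lparr>verts = set ws, edges = (\<lambda>i. {ws ! i, ws ! (Suc i mod ?k)}) ` {..<?k}\<rparr>"
  have "set ws \<subseteq> verts G"
    using EG simple_graph_edgeD(1)[OF assms(1)] ws(2) by (fastforce simp: in_set_conv_nth)
  moreover have "edges H \<subseteq> edges G" using EG by (auto simp: H_def)
  moreover have "simple_graph H"
    using assms(1) EG ws(2) mod_k by (fastforce simp: H_def simple_graph_def)
  ultimately have "subgraph H G" by (simp add: subgraph_def H_def)
  moreover have "isomorphic H C"
    unfolding isomorphic_def
  proof (intro exI conjI)
    define f where "f = (!) vs \<circ> inv_into {..<?k} ((!) ws)"
    have bij_ws: "bij_betw ((!) ws) {..<?k} (set ws)" and bij_vs: "bij_betw ((!) vs) {..<?k} (set vs)"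
      using ws vs by (simp_all add: bij_betw_nth)
    then show "bij_betw f (verts H) (verts C)"
      using vs(3) by (auto simp: f_def H_def intro: bij_betw_trans bij_betw_inv_into)
    have f_nth: "f (ws ! i) = vs ! i" if "i < ?k" for i
      using bij_ws that by (simp add: f_def bij_betw_def)
    have "(`) f ` edges H = (\<lambda>i. {f (ws ! i), f (ws ! (Suc i mod ?k))}) ` {..<?k}"
      by (simp add: H_def image_image)
    also have "\<dots> = (\<lambda>i. {vs ! i, vs ! (Suc i mod ?k)}) ` {..<?k}"
      using mod_k by (intro image_cong) (auto simp: f_nth)
    finally show "(`) f ` edges H = edges C" using EC by auto
  qed
  ultimately show "contains_from G \<Gamma>" using C(1) by (auto simp: contains_from_def)
qed

text \<open>Unrolls the cycle into a periodic sequence, so that neighbours are consecutive terms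
  without wrap-around cases. The last property says that any \<open>k\<close> consecutive terms are
  distinct.\<close>

lemma has_cycleE:
  assumes "has_cycle G k"
  obtains c where "3 \<le> k" "\<And>i. {c i, c (Suc i)} \<in> edges G" "\<And>i. c (i + k) = c i"
    "\<And>i a b. a < k \<Longrightarrow> b < k \<Longrightarrow> c (i + a) = c (i + b) \<longleftrightarrow> a = b"
proof -
  obtain vs where vs: "distinct vs" "length vs = k" "3 \<le> k"
    and E: "\<And>i. i < k \<Longrightarrow> {vs ! i, vs ! (Suc i mod k)} \<in> edges G"
    using assms by (auto simp: has_cycle_def)
  have k: "0 < k" using vs(3) by simp
  define c where "c = (\<lambda>i. vs ! (i mod k))"
  have "{c i, c (Suc i)} \<in> edges G" for i
    using E[of "i mod k"] k by (simp add: c_def mod_Suc_eq)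
  moreover have "c (i + k) = c i" for i by (simp add: c_def)
  moreover have "c (i + a) = c (i + b) \<longleftrightarrow> a = b" if "a < k" "b < k" for i a b
  proof -
    have "c (i + a) = c (i + b) \<longleftrightarrow> (i + a) mod k = (i + b) mod k"
      using vs k by (simp add: c_def nth_eq_iff_index_eq)
    also have "\<dots> \<longleftrightarrow> a mod k = b mod k"
      unfolding nat_mod_eq_iff add.assoc add_left_cancel ..
    finally show ?thesis using \<open>a < k\<close> \<open>b < k\<close> by simp
  qed
  ultimately show thesis using that vs(3) by blast
qed

text \<open>Extracts what the later arguments use of a cycle: two neighbours within \<open>C\<close>
  for each of its vertices and, for length at least 4, a vertex \<open>r\<close> that together with
  two of its neighbours avoids a given \<open>v\<close>. If \<open>v\<close> lies on the cycle,
  \<open>r\<close> is two steps after it.\<close>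

lemma cycle_nbrs:
  assumes "has_cycle G k"
  obtains C where "card C = k" "\<And>v. v \<in> C \<Longrightarrow>
    \<exists>p\<in>C. \<exists>q\<in>C. p \<noteq> q \<and> p \<noteq> v \<and> q \<noteq> v \<and> {v, p} \<in> edges G \<and> {v, q} \<in> edges G"
    "\<And>v. 4 \<le> k \<Longrightarrow> \<exists>p\<in>C. \<exists>q\<in>C. \<exists>r\<in>C. p \<noteq> q \<and> p \<noteq> v \<and> q \<noteq> v \<and> r \<noteq> v \<and>
       {r, p} \<in> edges G \<and> {r, q} \<in> edges G"
proof -
  obtain c where k: "3 \<le> k" and E: "\<And>i. {c i, c (Suc i)} \<in> edges G"
    and per: "\<And>i. c (i + k) = c i"
    and inj: "\<And>i a b. a < k \<Longrightarrow> b < k \<Longrightarrow> c (i + a) = c (i + b) \<longleftrightarrow> a = b"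
    using has_cycleE[OF assms] by metis
  have "card (c ` {..<k}) = k"
    using inj[where i = 0] by (intro card_image[THEN trans] inj_onI) auto
  have range: "c ` {..<k} = range c"
  proof -
    have "c i = c (i mod k)" for i
    proof -
      have "c (i mod k + j * k) = c (i mod k)" for j
      proof (induction j)
        case (Suc j)
        then show ?case using per[of "i mod k + j * k"] by (simp add: add_ac)
      qed simp
      then show ?thesis by (metis div_mult_mod_eq add.commute)
    qed
    then show ?thesis using k by (fastforce intro: mod_less_divisor)
  qed
  have two: "\<exists>p\<in>range c. \<exists>q\<in>range c. p \<noteq> q \<and> p \<noteq> v \<and> q \<noteq> v \<and> {v, p} \<in> edges G \<and> {v, q} \<in> edges G"
    if "v \<in> range c" for v
  proof -
    obtain i where i: "v = c i" using \<open>v \<in> range c\<close> by blast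
    \<comment> \<open>The predecessor is reached by going forward k - 1 steps, which avoids
      subtraction from \<open>i\<close>.\<close>
    have "{c (i + (k - 1)), c i} \<in> edges G"
      using E[of "i + (k - 1)"] per[of i] k by simp
    moreover have "c (i + 1) \<noteq> c (i + (k - 1))" "c (i + 1) \<noteq> c (i + 0)" "c (i + (k - 1)) \<noteq> c (i + 0)"
      using k by (subst inj; simp)+
    ultimately show ?thesis
      using E[of i] i by (intro bexI[of _ "c (i + 1)"] bexI[of _ "c (i + (k - 1))"]) (auto simp: insert_commute)
  qed
  have opp: "\<exists>p\<in>range c. \<exists>q\<in>range c. \<exists>r\<in>range c. p \<noteq> q \<and> p \<noteq> v \<and> q \<noteq> v \<and> r \<noteq> v \<and>
       {r, p} \<in> edges G \<and> {r, q} \<in> edges G" if "4 \<le> k" for v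
  proof (cases "v \<in> range c")
    case True
    then obtain i where i: "v = c i" by blast
    have "c (i + 1) \<noteq> c (i + 3)" "c (i + 1) \<noteq> c (i + 0)" "c (i + 3) \<noteq> c (i + 0)" "c (i + 2) \<noteq> c (i + 0)"
      using that by (subst inj; simp)+
    then show ?thesis
      using E[of "i + 1"] E[of "i + 2"] i
      by (intro bexI[of _ "c (i + 1)"] bexI[of _ "c (i + 2)"] bexI[of _ "c (i + 3)"])
        (auto simp: insert_commute numeral_eq_Suc)
  next
    case False
    then show ?thesis using two[of "c 0"] by (metis rangeI)
  qed
  show thesis
    using that[of "range c"] \<open>card (c ` {..<k}) = k\<close> range two opp by auto
qed

text \<open>The label-free description of the extremal graphs: the vertex \<open>v\<close> misses at
  most one other vertex. \<open>isomorphic_\<G>_iff\<close> identifies these graphs on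
  \<open>n\<close> vertices with the three families.\<close>

definition near_star :: "'a graph \<Rightarrow> bool" where
  "near_star H \<longleftrightarrow> simple_graph H \<and> C4_free (\<lambda>u w. {u, w} \<in> edges H) \<and>
     (\<exists>v\<in>verts H. card (verts H) \<le> degree H v + 2)"

lemma finite_nbrs: "simple_graph H \<Longrightarrow> finite (nbrs H u)"
  by (simp add: nbrs_def simple_graph_def)

lemma near_star_centre:
  assumes "simple_graph H" "v \<in> verts H" "card (verts H) \<le> degree H v + 2"
  obtains y where "verts H \<subseteq> insert v (insert y (nbrs H v))"
proof -
  have fin: "finite (verts H)" using assms(1) by (simp add: simple_graph_def)
  have "v \<notin> nbrs H v" using simple_graph_edgeD(3)[OF assms(1), of v v] by (auto simp: nbrs_def)
  moreover have "nbrs H v \<subseteq> verts H" by (auto simp: nbrs_def)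
  ultimately have "card (verts H - insert v (nbrs H v)) = card (verts H) - Suc (degree H v)"
    using assms(2) fin by (simp add: card_Diff_subset finite_nbrs assms(1) degree_def)
  then have "card (verts H - insert v (nbrs H v)) \<le> Suc 0" using assms(3) by simp
  then have "\<exists>y. verts H - insert v (nbrs H v) \<subseteq> {y}"
    using fin by (metis card_le_Suc0_iff_eq finite_Diff subsetI singletonI empty_iff insertI1 ex_in_conv)
  then show thesis using that by blast
qed

text \<open>No vertex other than \<open>v\<close> shares two neighbours with \<open>v\<close>. Take
  \<open>r\<close> with two neighbours \<open>p\<close>, \<open>q\<close> on the cycle, all three
  different from \<open>v\<close>: one of \<open>p\<close>, \<open>q\<close> must be the
  non-neighbour \<open>y\<close> of \<open>v\<close>. Then both cycle neighbours of \<open>y\<close>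
  are adjacent to \<open>v\<close>, a contradiction.\<close>

lemma near_star_no_long_cycle:
  assumes "near_star H" "4 \<le> k"
  shows "\<not> has_cycle H k"
proof
  assume cyc: "has_cycle H k"
  obtain v where simple: "simple_graph H" and v: "v \<in> verts H" "card (verts H) \<le> degree H v + 2"
    and "C4_free (\<lambda>u w. {u, w} \<in> edges H)"
    using assms(1) by (auto simp: near_star_def)
  interpret C4_free "\<lambda>u w. {u, w} \<in> edges H" by fact
  obtain y where y: "verts H \<subseteq> insert v (insert y (nbrs H v))" by (rule near_star_centre[OF simple v])
  obtain C where "card C = k" and two: "\<And>v. v \<in> C \<Longrightarrow>
      \<exists>p\<in>C. \<exists>q\<in>C. p \<noteq> q \<and> p \<noteq> v \<and> q \<noteq> v \<and> {v, p} \<in> edges H \<and> {v, q} \<in> edges H"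
    and opp: "\<And>v. 4 \<le> k \<Longrightarrow> \<exists>p\<in>C. \<exists>q\<in>C. \<exists>r\<in>C. p \<noteq> q \<and> p \<noteq> v \<and> q \<noteq> v \<and> r \<noteq> v \<and>
       {r, p} \<in> edges H \<and> {r, q} \<in> edges H"
    by (rule cycle_nbrs[OF cyc], rule that)
  have no: "False" if "p \<noteq> q" "r \<noteq> v" "{r, p} \<in> edges H" "{r, q} \<in> edges H" "{v, p} \<in> edges H" "{v, q} \<in> edges H" for p q r
    using no_C4[of v p r q] that by (auto simp: insert_commute)
  have adj: "{v, p} \<in> edges H" if "p \<in> verts H" "p \<noteq> v" "p \<noteq> y" for p
    using y that by (auto simp: nbrs_def)
  obtain p q r where pqr: "p \<noteq> q" "r \<noteq> v" "{r, p} \<in> edges H" "{r, q} \<in> edges H" "p \<noteq> v" "q \<noteq> v"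
    and "p \<in> C" "q \<in> C" using opp[OF assms(2), of v] by blast
  show False
  proof (cases "{v, p} \<in> edges H \<and> {v, q} \<in> edges H")
    case True
    then show False using no pqr by blast
  next
    case False
    then have "y \<in> C" "{v, y} \<notin> edges H" "y \<noteq> v"
      using adj simple_graph_edgeD(2)[OF simple pqr(3)] simple_graph_edgeD(2)[OF simple pqr(4)] pqr(5,6)
        \<open>p \<in> C\<close> \<open>q \<in> C\<close> by blast+
    then obtain p' q' where "p' \<noteq> q'" "p' \<noteq> y" "q' \<noteq> y" "{y, p'} \<in> edges H" "{y, q'} \<in> edges H"
      using two[of y] by blast
    moreover from this have "p' \<noteq> v" "q' \<noteq> v" using \<open>{v, y} \<notin> edges H\<close> by (auto simp: insert_commute)
    ultimately show False
      using no[of p' q' y] adj[of p'] adj[of q'] \<open>y \<noteq> v\<close> simple_graph_edgeD(2)[OF simple] by blast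
  qed
qed

text \<open>A Hamiltonian cycle of \<open>K\<close> gives the centre two neighbours in
  \<open>K\<close>. These and the centre itself are three vertices outside its neighbourhood in
  \<open>H\<close>, where at most two exist.\<close>

lemma near_star_not_hamiltonian:
  assumes "near_star H" "simple_graph K" "verts K = verts H" "edges K \<inter> edges H = {}"
  shows "\<not> has_cycle K (card (verts H))"
proof
  assume cyc: "has_cycle K (card (verts H))"
  obtain v where simple: "simple_graph H" and v: "v \<in> verts H" "card (verts H) \<le> degree H v + 2"
    using assms(1) by (auto simp: near_star_def)
  have fin: "finite (verts H)" using simple by (simp add: simple_graph_def)
  obtain C where C: "card C = card (verts H)" and two: "\<And>v. v \<in> C \<Longrightarrow>
      \<exists>p\<in>C. \<exists>q\<in>C. p \<noteq> q \<and> p \<noteq> v \<and> q \<noteq> v \<and> {v, p} \<in> edges K \<and> {v, q} \<in> edges K"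
    using cycle_nbrs[OF cyc] by metis
  have "C \<subseteq> verts H"
    using two simple_graph_edgeD(1)[OF assms(2)] assms(3) by blast
  then have "v \<in> C" using card_subset_eq[OF fin _ C] v(1) by simp
  then obtain p q where pq: "p \<noteq> q" "p \<noteq> v" "q \<noteq> v" "{v, p} \<in> edges K" "{v, q} \<in> edges K"
    using two by blast
  then have "{v, p, q} \<subseteq> verts H" using simple_graph_edgeD[OF assms(2)] assms(3) by blast
  moreover have "nbrs H v \<inter> {v, p, q} = {}"
    using pq assms(4) simple_graph_edgeD(3)[OF simple, of v v] by (auto simp: nbrs_def)
  moreover have "nbrs H v \<subseteq> verts H" by (auto simp: nbrs_def)
  ultimately have "card (nbrs H v \<union> {v, p, q}) = card (nbrs H v) + 3"
    and "nbrs H v \<union> {v, p, q} \<subseteq> verts H"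
    using pq finite_nbrs[OF simple] by (auto simp: card_Un_disjoint)
  then have "card (nbrs H v) + 3 \<le> card (verts H)" using card_mono[OF fin] by metis
  then show False using v(2) by (simp add: degree_def)
qed

lemma has_cycle_le_card:
  assumes "simple_graph G" "has_cycle G k"
  shows "k \<le> card (verts G)"
proof -
  obtain C where C: "card C = k" and two: "\<And>v. v \<in> C \<Longrightarrow>
      \<exists>p\<in>C. \<exists>q\<in>C. p \<noteq> q \<and> p \<noteq> v \<and> q \<noteq> v \<and> {v, p} \<in> edges G \<and> {v, q} \<in> edges G"
    using cycle_nbrs[OF assms(2)] by metis
  then have "C \<subseteq> verts G" using simple_graph_edgeD(1)[OF assms(1)] by blast
  then show ?thesis using C assms(1) by (auto simp: simple_graph_def intro: card_mono)
qed

section \<open>The families of extremal graphs\<close>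

text \<open>Simplicity is assumed only of \<open>H\<close> and inherited by \<open>K\<close>, so the
  locale also applies to a graph \<open>K\<close> defined as the image of \<open>H\<close> under a
  labelling.\<close>

locale graph_iso =
  fixes H :: "'a graph" and K :: "'b graph" and f :: "'a \<Rightarrow> 'b"
  assumes simple: "simple_graph H"
    and bij: "bij_betw f (verts H) (verts K)"
    and edges: "(`) f ` edges H = edges K"
begin

lemma inj: "inj_on f (verts H)" and image_verts: "f ` verts H = verts K"
  using bij by (simp_all add: bij_betw_def)

lemma simple_K: "simple_graph K"
proof -
  have "finite (verts K)" using simple image_verts by (metis simple_graph_def finite_imageI)
  moreover have "e' \<subseteq> verts K \<and> card e' = 2" if "e' \<in> edges K" for e'
  proof -
    obtain e where "e \<in> edges H" "e' = f ` e" using \<open>e' \<in> edges K\<close> edges by blast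
    moreover from this have "e \<subseteq> verts H" "card e = 2" using simple by (auto simp: simple_graph_def)
    ultimately show ?thesis
      using inj image_verts by (metis card_image image_mono inj_on_subset)
  qed
  ultimately show ?thesis by (simp add: simple_graph_def)
qed

lemma edge_iff:
  assumes "u \<in> verts H" "w \<in> verts H"
  shows "{f u, f w} \<in> edges K \<longleftrightarrow> {u, w} \<in> edges H"
proof
  assume "{f u, f w} \<in> edges K"
  then obtain e where e: "e \<in> edges H" "f ` {u, w} = f ` e"
    using edges unfolding image_insert image_empty by blast
  then have "e \<subseteq> verts H" using simple by (auto simp: simple_graph_def)
  moreover have "{u, w} \<subseteq> verts H" using assms by simp
  ultimately have "e = {u, w}" using inj_on_image_eq_iff[OF inj] e(2) by metis
  then show "{u, w} \<in> edges H" using e(1) by simp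
next
  assume "{u, w} \<in> edges H"
  then have "f ` {u, w} \<in> edges K" using edges by blast
  then show "{f u, f w} \<in> edges K" by simp
qed

lemma nbrs_image:
  assumes "u \<in> verts H"
  shows "nbrs K (f u) = f ` nbrs H u"
proof -
  have "{w \<in> f ` verts H. {f u, w} \<in> edges K} = f ` {w \<in> verts H. {f u, f w} \<in> edges K}" by blast
  also have "{w \<in> verts H. {f u, f w} \<in> edges K} = {w \<in> verts H. {u, w} \<in> edges H}"
    using assms edge_iff by blast
  finally show ?thesis by (simp add: nbrs_def image_verts)
qed

lemma degree_eq:
  assumes "u \<in> verts H"
  shows "degree K (f u) = degree H u"
proof -
  have "card (f ` nbrs H u) = card (nbrs H u)"
    by (intro card_image inj_on_subset[OF inj]) (auto simp: nbrs_def)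
  then show ?thesis using assms by (simp add: degree_def nbrs_image)
qed

lemma card_verts: "card (verts K) = card (verts H)"
  using bij by (simp add: bij_betw_same_card)

lemma near_star_pullback:
  assumes "near_star K"
  shows "near_star H"
proof -
  obtain v' where v': "v' \<in> verts K" "card (verts K) \<le> degree K v' + 2"
    and "C4_free (\<lambda>u w. {u, w} \<in> edges K)"
    using assms by (auto simp: near_star_def)
  interpret K: C4_free "\<lambda>u w. {u, w} \<in> edges K" by fact
  obtain v where "v \<in> verts H" "v' = f v" using v'(1) image_verts by blast
  then have "card (verts H) \<le> degree H v + 2" using v'(2) degree_eq card_verts by simp
  moreover have "C4_free (\<lambda>u w. {u, w} \<in> edges H)"
  proof
    fix a b c d
    assume E: "{a, b} \<in> edges H" "{b, c} \<in> edges H" "{c, d} \<in> edges H" "{d, a} \<in> edges H"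
    then have V: "a \<in> verts H" "b \<in> verts H" "c \<in> verts H" "d \<in> verts H"
      using simple_graph_edgeD[OF simple] by blast+
    then have "f a = f c \<or> f b = f d" using K.no_C4[of "f a" "f b" "f c" "f d"] E edge_iff by auto
    then show "a = c \<or> b = d" using inj V by (auto dest: inj_onD)
  next
    show "{u, u} \<notin> edges H" for u using simple_graph_edgeD(3)[OF simple, of u u] by blast
  qed (simp add: insert_commute)
  ultimately show ?thesis using simple \<open>v \<in> verts H\<close> by (auto simp: near_star_def)
qed

end

section \<open>Matchings, and near-stars as members of the three families\<close>

lemma has_matching_on_iff:
  assumes "simple_graph H"
  shows "has_matching_on H U \<longleftrightarrow> U \<subseteq> verts H \<and>
    (\<forall>u\<in>U. \<forall>p\<in>U. \<forall>q\<in>U. {u, p} \<in> edges H \<longrightarrow> {u, q} \<in> edges H \<longrightarrow> p = q)"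
proof (cases "U \<subseteq> verts H")
  case True
  then have "finite U" using assms by (auto simp: simple_graph_def intro: finite_subset)
  then have "degree (induced_subgraph H U) u \<le> 1 \<longleftrightarrow>
      (\<forall>p\<in>U. \<forall>q\<in>U. {u, p} \<in> edges H \<longrightarrow> {u, q} \<in> edges H \<longrightarrow> p = q)" if "u \<in> U" for u
    using that by (auto simp: degree_def nbrs_def induced_subgraph_def card_le_Suc0_iff_eq)
  then show ?thesis by (simp add: has_matching_on_def)
qed (simp add: has_matching_on_def)

text \<open>Every vertex of a 4-cycle has two neighbours, so it lies in \<open>U\<close> or equals
  \<open>v\<close>. Some three consecutive vertices avoid \<open>v\<close>, and the middle one has
  two neighbours in \<open>U\<close>, against the matching.\<close>

lemma C4_free_of_matching:
  assumes simple: "simple_graph H" and match: "has_matching_on H U"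
    and low: "\<And>u. u \<in> verts H \<Longrightarrow> u \<notin> U \<Longrightarrow> u \<noteq> v \<Longrightarrow> degree H u \<le> 1"
  shows "C4_free (\<lambda>u w. {u, w} \<in> edges H)"
proof
  show irrefl: "{u, u} \<notin> edges H" for u using simple_graph_edgeD(3)[OF simple, of u u] by blast
  fix a b c d
  assume E: "{a, b} \<in> edges H" "{b, c} \<in> edges H" "{c, d} \<in> edges H" "{d, a} \<in> edges H"
  show "a = c \<or> b = d"
  proof (rule ccontr)
    assume ne: "\<not> (a = c \<or> b = d)"
    have U: "u \<in> U \<or> u = v" if "{u, p} \<in> edges H" "{u, q} \<in> edges H" "p \<noteq> q" for u p q
    proof (rule ccontr)
      assume "\<not> (u \<in> U \<or> u = v)"
      then have "degree H u \<le> 1" using low simple_graph_edgeD(1)[OF simple that(1)] by blast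
      moreover have "p \<in> nbrs H u" "q \<in> nbrs H u"
        using that simple_graph_edgeD(2)[OF simple] by (auto simp: nbrs_def)
      ultimately show False
        using that(3) finite_nbrs[OF simple, of u] by (auto simp: degree_def card_le_Suc0_iff_eq)
    qed
    have "u = v \<or> p = v \<or> q = v"
      if "u \<in> U \<or> u = v" "p \<in> U \<or> p = v" "q \<in> U \<or> q = v" "{u, p} \<in> edges H" "{u, q} \<in> edges H" "p \<noteq> q"
      for u p q
      using that match has_matching_on_iff[OF simple] by blast
    note M = this
    have E': "{b, a} \<in> edges H" "{c, b} \<in> edges H" "{d, c} \<in> edges H" "{a, d} \<in> edges H"
      using E by (simp_all add: insert_commute)
    have "a \<in> U \<or> a = v" "b \<in> U \<or> b = v" "c \<in> U \<or> c = v" "d \<in> U \<or> d = v"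
      using U E E' ne by metis+
    moreover have "a \<noteq> b" "b \<noteq> c" "c \<noteq> d" "d \<noteq> a" using E irrefl by auto
    ultimately show False using M[of a b d] M[of b a c] M[of c b d] M[of d a c] E E' ne by auto
  qed
qed (simp add: insert_commute)

lemma card_X_set: "finite (X_set n)" "card (X_set n) = n - 2"
  by (simp_all add: X_set_def card_image inj_on_def)

lemma \<G>_near_star:
  assumes K: "K \<in> \<G>1 n \<union> \<G>2 n \<union> \<G>3 n" and n: "3 \<le> n"
  shows "near_star K" "card (verts K) = n"
proof -
  let ?v = vert_v
  have simple: "simple_graph K" and V: "verts K = {?v} \<union> X_set n \<union> {vert_y}"
    using K by (auto simp: \<G>1_def \<G>2_def \<G>3_def graphs_on_def)
  have nin: "?v \<notin> X_set n" "vert_y \<notin> X_set n" by (auto simp: X_set_def)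
  show card: "card (verts K) = n" using n V nin by (simp add: card_X_set)
  have "nbrs K ?v = X_set n \<or> nbrs K ?v = X_set n \<union> {vert_y}"
    using K by (auto simp: \<G>1_def \<G>2_def \<G>3_def)
  then have "n - 2 \<le> degree K ?v"
    using nin by (elim disjE) (simp_all add: degree_def card_X_set)
  moreover have "C4_free (\<lambda>u w. {u, w} \<in> edges K)"
  \<comment> \<open>In \<open>\<G>2 n\<close> the edge at \<open>vert_y\<close> may violate the
    matching on the larger set, so \<open>vert_y\<close> is left out and covered by its degree
    1.\<close>
  proof (cases "K \<in> \<G>2 n")
    case True
    then have "has_matching_on K (X_set n)" "nbrs K vert_y = {vert_x (n - 2)}"
      by (simp_all add: \<G>2_def)
    then have "has_matching_on K (X_set n)" "degree K vert_y \<le> 1" by (simp_all add: degree_def)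
    then show ?thesis using V by (intro C4_free_of_matching[OF simple, where v = ?v]) auto
  next
    case False
    then have "has_matching_on K (X_set n \<union> {vert_y})" using K by (auto simp: \<G>1_def \<G>3_def)
    then show ?thesis using V by (intro C4_free_of_matching[OF simple, where v = ?v]) auto
  qed
  ultimately show "near_star K" unfolding near_star_def card using simple V by (intro conjI bexI[of _ ?v]) simp_all
qed

text \<open>The vertex \<open>x\<close> receives the last index because \<open>\<G>2\<close> singles
  it out; the other n - 3 vertices are labelled arbitrarily. Injectivity follows by counting the
  image.\<close>

lemma labelling_exists:
  assumes "finite V" "card V = n" "v \<in> V" "y \<in> V" "x \<in> V" "distinct [v, y, x]"
  obtains f where "bij_betw f V ({vert_v} \<union> X_set n \<union> {vert_y})"
    "f v = vert_v" "f y = vert_y" "f x = vert_x (n - 2)" "f ` (V - {v, y}) = X_set n"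
proof -
  let ?W = "V - {v, y, x}"
  have card_W: "card ?W = n - 3" and n: "3 \<le> n"
    using assms card_mono[of V "{v, y, x}"] by (auto simp: card_Diff_subset)
  have "card (vert_x ` {1..n - 3}) = n - 3" by (simp add: card_image inj_on_def)
  then obtain g where g: "bij_betw g ?W (vert_x ` {1..n - 3})"
    using finite_same_card_bij[of ?W "vert_x ` {1..n - 3}"] assms(1) card_W by auto
  define f where "f = g(v := vert_v, y := vert_y, x := vert_x (n - 2))"
  have X: "X_set n = insert (vert_x (n - 2)) (vert_x ` {1..n - 3})"
  proof -
    have "{1..n - 2} = insert (n - 2) {1..n - 3}" using n by auto
    then show ?thesis by (simp add: X_set_def)
  qed
  have f: "f v = vert_v" "f y = vert_y" "f x = vert_x (n - 2)" using assms(6) by (auto simp: f_def)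
  have "f ` ?W = g ` ?W" by (intro image_cong) (auto simp: f_def)
  then have fW: "f ` ?W = vert_x ` {1..n - 3}" using g by (simp add: bij_betw_def)
  have "V - {v, y} = insert x ?W" using assms by auto
  then have "f ` (V - {v, y}) = X_set n" using fW f(3) X by simp
  moreover have image: "f ` V = {vert_v} \<union> X_set n \<union> {vert_y}"
  proof -
    have "V = insert v (insert y (V - {v, y}))" using assms by auto
    then have "f ` V = insert (f v) (insert (f y) (f ` (V - {v, y})))" by (metis image_insert)
    then show ?thesis using \<open>f ` (V - {v, y}) = X_set n\<close> f by auto
  qed
  moreover have "card (f ` V) = card V"
    using image n assms(2) card_X_set by (simp add: X_set_def card_insert_if image_iff)
  then have "inj_on f V" using assms(1) by (simp add: eq_card_imp_inj_on)
  ultimately show thesis using that f by (simp add: bij_betw_def)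
qed

text \<open>Let \<open>y\<close> be the vertex missed by \<open>v\<close>, or any other vertex if
  none is missed. If \<open>v\<close> and \<open>y\<close> are adjacent, the graph is in
  \<open>\<G>3\<close>. Otherwise it is in \<open>\<G>1\<close> unless the only neighbour
  \<open>x\<close> of \<open>y\<close> has a further neighbour besides \<open>v\<close>, which gives
  \<open>\<G>2\<close>.\<close>

lemma near_star_in_\<G>:
  assumes "near_star H" "card (verts H) = n" "3 \<le> n"
  shows "\<exists>K \<in> \<G>1 n \<union> \<G>2 n \<union> \<G>3 n. isomorphic H K"
proof -
  let ?V = "verts H"
  obtain v where simple: "simple_graph H" and v: "v \<in> ?V" "card ?V \<le> degree H v + 2"
    and "C4_free (\<lambda>u w. {u, w} \<in> edges H)"
    using assms(1) by (auto simp: near_star_def)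
  interpret C4_free "\<lambda>u w. {u, w} \<in> edges H" by fact
  have fin: "finite ?V" using simple by (simp add: simple_graph_def)
  obtain y where y: "y \<in> ?V" "y \<noteq> v" and y_cover: "?V - {v, y} \<subseteq> nbrs H v"
  proof -
    obtain y where y: "?V \<subseteq> insert v (insert y (nbrs H v))" by (rule near_star_centre[OF simple v])
    show thesis
    proof (cases "y \<in> ?V - {v}")
      case True
      then show thesis using that[of y] y by auto
    next
      case False
      have "card (?V - {v}) \<noteq> 0" using v(1) assms(2,3) by simp
      then obtain z where "z \<in> ?V - {v}" by (metis card.empty ex_in_conv)
      then show thesis using that[of z] y False by auto
    qed
  qed
  have v_nbrs: "nbrs H v \<subseteq> ?V - {v}" using irrefl[of v] by (auto simp: nbrs_def)
  \<comment> \<open>A vertex \<open>u\<close> other than \<open>v\<close> has at most one neighbour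
    among those of \<open>v\<close>; this yields all the matchings.\<close>
  have match: "p = q" if "u \<noteq> v" "{u, p} \<in> edges H" "{u, q} \<in> edges H" "p \<in> nbrs H v" "q \<in> nbrs H v"
    for u p q
    using no_C4[of v p u q] that by (auto simp: nbrs_def insert_commute)
  have "card (?V - {v, y}) \<noteq> 0" using v(1) y assms(2,3) fin by (simp add: card_Diff_subset)
  then obtain x0 where x0: "x0 \<in> ?V - {v, y}" by (metis card.empty ex_in_conv)
  \<comment> \<open>\<open>x\<close> is the only possible neighbour of \<open>y\<close> apart from
    \<open>v\<close>. If there is none, the arbitrary \<open>x0\<close> serves, as the labelling
    needs some third vertex.\<close>
  obtain x where x: "x \<in> ?V - {v, y}" and y_nbrs: "\<And>z. z \<in> ?V - {v, y} \<Longrightarrow> {y, z} \<in> edges H \<Longrightarrow> z = x"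
  proof (cases "\<exists>z\<in>?V - {v, y}. {y, z} \<in> edges H")
    case True
    then obtain z where "z \<in> ?V - {v, y}" "{y, z} \<in> edges H" by blast
    then show thesis using that[of z] match[OF y(2)] y_cover by blast
  next
    case False
    then show thesis using that[OF x0] by blast
  qed
  obtain f where bij: "bij_betw f ?V ({vert_v} \<union> X_set n \<union> {vert_y})"
    and f: "f v = vert_v" "f y = vert_y" "f x = vert_x (n - 2)" and fX: "f ` (?V - {v, y}) = X_set n"
    using labelling_exists[OF fin assms(2) v(1) y(1), of x] x y(2) by auto
  define K where "K = \<lparr>verts = {vert_v} \<union> X_set n \<union> {vert_y}, edges = (`) f ` edges H\<rparr>"
  have "graph_iso H K f" using simple bij by (simp add: graph_iso_def K_def)
  then interpret graph_iso H K f .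
  have iso: "isomorphic H K" unfolding isomorphic_def by (intro exI conjI) (rule bij edges)+
  have on: "K \<in> graphs_on n" using simple_K by (simp add: graphs_on_def K_def)
  have matching: "has_matching_on K (f ` U)"
    if "U \<subseteq> ?V" and *: "\<And>u p q. u \<in> U \<Longrightarrow> p \<in> U \<Longrightarrow> q \<in> U \<Longrightarrow> {u, p} \<in> edges H \<Longrightarrow> {u, q} \<in> edges H \<Longrightarrow> p = q"
    for U
  proof -
    have sub: "f ` U \<subseteq> verts K" using \<open>U \<subseteq> ?V\<close> image_verts by blast
    have "f p = f q" if "u \<in> U" "p \<in> U" "q \<in> U" "{f u, f p} \<in> edges K" "{f u, f q} \<in> edges K" for u p q
      using that edge_iff[of u p] edge_iff[of u q] \<open>U \<subseteq> ?V\<close> *[of u p q] by (metis subsetD)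
    then show ?thesis using sub unfolding has_matching_on_iff[OF simple_K] by blast
  qed
  have nbrs_v: "nbrs K vert_v = f ` nbrs H v" using nbrs_image[OF v(1)] f(1) by simp
  have XY: "X_set n \<union> {vert_y} = f ` (?V - {v})"
  proof -
    have "?V - {v} = insert y (?V - {v, y})" using y by auto
    then show ?thesis using fX f(2) by simp
  qed
  have "K \<in> \<G>1 n \<union> \<G>2 n \<union> \<G>3 n"
  proof (cases "y \<in> nbrs H v")
    case True
    then have N: "nbrs H v = ?V - {v}" using y_cover v_nbrs by auto
    then have "has_matching_on K (X_set n \<union> {vert_y})"
      unfolding XY using match by (intro matching) auto
    then show ?thesis using on N nbrs_v XY by (simp add: \<G>3_def)
  next
    case False
    then have N: "nbrs H v = ?V - {v, y}" using y_cover v_nbrs by auto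
    then have nbrs_X: "nbrs K vert_v = X_set n" using nbrs_v fX by simp
    show ?thesis
    proof (cases "has_matching_on K (X_set n \<union> {vert_y})")
      case True
      then show ?thesis using on nbrs_X by (simp add: \<G>1_def)
    next
      case no_match: False
      \<comment> \<open>By \<open>match\<close> a violation must involve \<open>y\<close>, and
        \<open>y\<close> itself has too few neighbours to be \<open>u\<close>. Hence
        \<open>u\<close> is adjacent to \<open>y\<close>, so it is \<open>x\<close>, and its other
        neighbour is the third one required by \<open>\<G>2\<close>.\<close>
      then obtain u p q where upq: "u \<in> ?V - {v}" "p \<in> ?V - {v}" "q \<in> ?V - {v}"
        "{u, p} \<in> edges H" "{u, q} \<in> edges H" "p \<noteq> q"
        using matching[of "?V - {v}"] XY by auto
      have vy: "{v, y} \<notin> edges H" "{y, v} \<notin> edges H"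
        using False y(1) by (auto simp: nbrs_def insert_commute)
      have "u \<noteq> y" using upq y_nbrs irrefl by (metis Diff_iff insert_iff empty_iff)
      moreover have "p = y \<or> q = y" using match[of u p q] upq N by auto
      ultimately obtain q where q: "q \<in> ?V - {v, y}" "{u, q} \<in> edges H" "{u, y} \<in> edges H" "u \<in> ?V - {v, y}"
        using upq by blast
      then have u: "u = x" using y_nbrs[of u] by (simp add: insert_commute)
      have xE: "{y, x} \<in> edges H" "{x, y} \<in> edges H" "{x, q} \<in> edges H"
        using q(2,3) u sym[of u y] by simp_all
      have "{x, v} \<in> edges H" using sym[of v x] x y_cover unfolding nbrs_def by blast
      have "z = x" if "z \<in> ?V" "{y, z} \<in> edges H" for z
        using y_nbrs[of z] vy irrefl that by blast
      then have "nbrs H y = {x}" using xE x unfolding nbrs_def by blast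
      then have "nbrs K vert_y = {vert_x (n - 2)}" using nbrs_image[OF y(1)] f by simp
      moreover have "nbrs H x = {v, y, q}"
      proof -
        have "z = q" if "z \<in> ?V - {v, y}" "{x, z} \<in> edges H" for z
          using match[of x z q] that q(1) xE(3) x unfolding N by blast
        then show ?thesis using xE \<open>{x, v} \<in> edges H\<close> q(1) v(1) y(1) unfolding nbrs_def by blast
      qed
      then have "degree H x = 3" using q(1) y(2) by (auto simp: degree_def)
      then have "degree K (vert_x (n - 2)) = 3" using degree_eq[of x] x f(3) by simp
      moreover have "has_matching_on K (X_set n)"
        unfolding fX[symmetric]
        using match[unfolded N] by (intro matching) auto
      ultimately show ?thesis using on nbrs_X by (simp add: \<G>2_def)
    qed
  qed
  then show ?thesis using iso by blast
qed

lemma isomorphic_\<G>_iff: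
  assumes "simple_graph H" "3 \<le> n"
  shows "(\<exists>K \<in> \<G>1 n \<union> \<G>2 n \<union> \<G>3 n. isomorphic H K) \<longleftrightarrow> near_star H \<and> card (verts H) = n"
proof
  assume "\<exists>K \<in> \<G>1 n \<union> \<G>2 n \<union> \<G>3 n. isomorphic H K"
  then obtain K f where K: "K \<in> \<G>1 n \<union> \<G>2 n \<union> \<G>3 n"
    and "bij_betw f (verts H) (verts K)" "(`) f ` edges H = edges K"
    by (auto simp: isomorphic_def)
  then interpret graph_iso H K f using assms(1) by unfold_locales
  show "near_star H \<and> card (verts H) = n"
    using \<G>_near_star[OF K assms(2)] near_star_pullback card_verts by simp
qed (use near_star_in_\<G> assms in blast)

section \<open>Critical colourings\<close>

lemma simple_colour_subgraphs:
  assumes "red_blue_graph G"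
  shows "simple_graph (red_subgraph G)" "simple_graph (blue_subgraph G)"
proof -
  have "simple_graph G" using assms by (simp add: red_blue_graph_def complete_graph_def)
  then show "simple_graph (red_subgraph G)" "simple_graph (blue_subgraph G)"
    by (simp_all add: simple_graph_def red_subgraph_def blue_subgraph_def)
qed

lemma red_iff_not_blue:
  assumes "red_blue_graph G" "u \<in> verts G" "w \<in> verts G" "u \<noteq> w"
  shows "{u, w} \<in> edges (red_subgraph G) \<longleftrightarrow> {u, w} \<notin> edges (blue_subgraph G)"
proof -
  have "{u, w} \<in> edges G" using assms by (simp add: red_blue_graph_def complete_graph_def)
  then show ?thesis
    by (cases "colour G {u, w}") (simp_all add: red_subgraph_def blue_subgraph_def)
qed

lemma C4_free_iff_no_cycle:
  assumes "simple_graph H"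
  shows "C4_free (\<lambda>u w. {u, w} \<in> edges H) \<longleftrightarrow> \<not> has_cycle H 4"
proof
  assume "C4_free (\<lambda>u w. {u, w} \<in> edges H)"
  then interpret C4_free "\<lambda>u w. {u, w} \<in> edges H" .
  show "\<not> has_cycle H 4"
  proof
    assume "has_cycle H 4"
    then obtain vs where vs: "distinct vs" "length vs = 4"
      and E: "\<forall>i<4. {vs ! i, vs ! (Suc i mod 4)} \<in> edges H" by (auto simp: has_cycle_def)
    obtain a b c d where abcd: "vs = [a, b, c, d]"
      using vs(2) by (auto simp: numeral_eq_Suc length_Suc_conv)
    have "{a, b} \<in> edges H" "{b, c} \<in> edges H" "{c, d} \<in> edges H" "{d, a} \<in> edges H"
      using E[rule_format, of 0] E[rule_format, of 1] E[rule_format, of 2] E[rule_format, of 3]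
      by (simp_all add: abcd)
    then show False using no_C4 vs(1) abcd by fastforce
  qed
next
  assume no: "\<not> has_cycle H 4"
  have irrefl: "{u, u} \<notin> edges H" for u using simple_graph_edgeD(3)[OF assms, of u u] by blast
  show "C4_free (\<lambda>u w. {u, w} \<in> edges H)"
  proof
    fix a b c d
    assume E: "{a, b} \<in> edges H" "{b, c} \<in> edges H" "{c, d} \<in> edges H" "{d, a} \<in> edges H"
    show "a = c \<or> b = d"
    proof (rule ccontr)
      assume "\<not> (a = c \<or> b = d)"
      then have "distinct [a, b, c, d]" using E irrefl by auto
      moreover have "\<forall>i<4. {[a, b, c, d] ! i, [a, b, c, d] ! (Suc i mod 4)} \<in> edges H"
      proof (intro allI impI)
        fix i :: nat assume "i < 4"
        then consider "i = 0" | "i = 1" | "i = 2" | "i = 3" by linarith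
        then show "{[a, b, c, d] ! i, [a, b, c, d] ! (Suc i mod 4)} \<in> edges H"
          using E by cases simp_all
      qed
      ultimately have "has_cycle H 4" unfolding has_cycle_def by (intro exI[of _ "[a, b, c, d]"]) simp
      then show False using no by simp
    qed
  qed (use irrefl in \<open>simp_all add: insert_commute\<close>)
qed

text \<open>A non-blue pair is red only if its vertices differ; length at least 3 ensures this for
  consecutive entries, including the closing pair.\<close>

lemma closed_path_imp_red_cycle:
  assumes "red_blue_graph G" "closed_path (\<lambda>u w. {u, w} \<notin> edges (blue_subgraph G)) cs"
    and "set cs \<subseteq> verts G" "3 \<le> length cs"
  shows "has_cycle (red_subgraph G) (length cs)"
  unfolding has_cycle_def
proof (intro exI[of _ cs] conjI allI impI)
  show distinct: "distinct cs" using assms(2) by (simp add: closed_path_def)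
  fix i assume i: "i < length cs"
  let ?j = "Suc i mod length cs"
  have j: "?j < length cs" using i by (intro mod_less_divisor) auto
  have "i \<noteq> ?j" using assms(4) i by (auto simp: mod_Suc)
  then have "cs ! i \<noteq> cs ! ?j" using distinct i j by (simp add: nth_eq_iff_index_eq)
  moreover have "{cs ! i, cs ! ?j} \<notin> edges (blue_subgraph G)"
  proof (cases "Suc i < length cs")
    case True
    then show ?thesis using assms(2) by (simp add: closed_path_def successively_conv_nth)
  next
    case False
    then have "Suc i = length cs" using i by simp
    then show ?thesis using assms(2) by (auto simp: closed_path_def last_conv_nth hd_conv_nth simp flip: \<open>Suc i = length cs\<close>)
  qed
  ultimately show "{cs ! i, cs ! ?j} \<in> edges (red_subgraph G)"
    using red_iff_not_blue[OF assms(1)] assms(3) i j by (meson nth_mem subsetD)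
qed (use assms(4) in auto)

text \<open>The contrapositive of \<open>hamiltonian_complement\<close>. It allows a subset
  \<open>V\<close> so that it applies to any \<open>n\<close> of the n + 1 vertices in
  \<open>not_avoiding_Suc\<close>.\<close>

lemma large_blue_degree:
  assumes G: "red_blue_graph G" and C4: "\<not> has_cycle (blue_subgraph G) 4"
    and V: "V \<subseteq> verts G" "card V = n" "6 \<le> n" and no_red: "\<not> has_cycle (red_subgraph G) n"
  shows "\<exists>v\<in>V. n \<le> card {u \<in> V. {v, u} \<in> edges (blue_subgraph G)} + 2"
proof (rule ccontr)
  assume *: "\<not> ?thesis"
  interpret C4_free "\<lambda>u w. {u, w} \<in> edges (blue_subgraph G)"
    using C4 C4_free_iff_no_cycle simple_colour_subgraphs(2)[OF G] by blast
  have "\<exists>cs. closed_path R cs \<and> set cs = V"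
    using * by (intro hamiltonian_complement[OF V(3,2)]) fastforce
  then obtain cs where cs: "closed_path R cs" "set cs = V" by blast
  then have "length cs = n" using V(2) distinct_card[of cs] by (simp add: closed_path_def)
  then show False using closed_path_imp_red_cycle[OF G cs(1)] cs(2) V no_red by simp
qed

lemma shortest_cycle_length:
  assumes "\<Gamma> \<noteq> {}"
  shows "\<exists>C\<in>\<Gamma>. cycle_length C = shortest_cycle_length \<Gamma>"
    and "C \<in> \<Gamma> \<Longrightarrow> shortest_cycle_length \<Gamma> \<le> cycle_length C"
proof -
  show "\<exists>C\<in>\<Gamma>. cycle_length C = shortest_cycle_length \<Gamma>"
    unfolding shortest_cycle_length_def by (rule LeastI_ex) (use assms in blast)
  show "C \<in> \<Gamma> \<Longrightarrow> shortest_cycle_length \<Gamma> \<le> cycle_length C"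
    unfolding shortest_cycle_length_def by (rule Least_le) blast
qed

section \<open>Avoiding colourings and the Ramsey number\<close>

locale cycle_families =
  fixes \<Gamma>1 :: "'b graph set" and \<Gamma>2 :: "'c graph set" and n :: nat
  assumes \<Gamma>1: "\<Gamma>1 \<noteq> {}" "\<forall>C\<in>\<Gamma>1. is_cycle C" "shortest_cycle_length \<Gamma>1 = n"
    and \<Gamma>2: "\<Gamma>2 \<noteq> {}" "\<forall>C\<in>\<Gamma>2. is_cycle C" "shortest_cycle_length \<Gamma>2 = 4"
    and n: "6 \<le> n"
begin

lemma avoidingD:
  assumes "avoiding \<Gamma>1 \<Gamma>2 G"
  shows "\<not> has_cycle (red_subgraph G) n" "\<not> has_cycle (blue_subgraph G) 4"
proof -
  have G: "red_blue_graph G" and no: "\<not> contains_from (red_subgraph G) \<Gamma>1" "\<not> contains_from (blue_subgraph G) \<Gamma>2"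
    using assms by (simp_all add: avoiding_def)
  show "\<not> has_cycle (red_subgraph G) n"
    using no(1) contains_from_iff[OF simple_colour_subgraphs(1)[OF G] \<Gamma>1(2)]
      shortest_cycle_length(1)[OF \<Gamma>1(1)] \<Gamma>1(3) by metis
  show "\<not> has_cycle (blue_subgraph G) 4"
    using no(2) contains_from_iff[OF simple_colour_subgraphs(2)[OF G] \<Gamma>2(2)]
      shortest_cycle_length(1)[OF \<Gamma>2(1)] \<Gamma>2(3) by metis
qed

lemma avoiding_if_near_star:
  assumes G: "red_blue_graph G" and star: "near_star (blue_subgraph G)" and le: "card (verts G) \<le> n"
  shows "avoiding \<Gamma>1 \<Gamma>2 G"
proof -
  have simple: "simple_graph (red_subgraph G)" "simple_graph (blue_subgraph G)"
    using simple_colour_subgraphs[OF G] .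
  have verts: "verts (red_subgraph G) = verts G" "verts (blue_subgraph G) = verts G"
    by (simp_all add: red_subgraph_def blue_subgraph_def)
  have "\<not> has_cycle (red_subgraph G) (cycle_length C)" if "C \<in> \<Gamma>1" for C
  proof
    assume cyc: "has_cycle (red_subgraph G) (cycle_length C)"
    have "n \<le> cycle_length C" using shortest_cycle_length(2)[OF \<Gamma>1(1) that] \<Gamma>1(3) by simp
    then have "cycle_length C = card (verts G)"
      using has_cycle_le_card[OF simple(1) cyc] le verts by simp
    moreover have "edges (red_subgraph G) \<inter> edges (blue_subgraph G) = {}"
      by (auto simp: red_subgraph_def blue_subgraph_def)
    ultimately show False using near_star_not_hamiltonian[OF star simple(1)] cyc verts by simp
  qed
  moreover have "\<not> has_cycle (blue_subgraph G) (cycle_length C)" if "C \<in> \<Gamma>2" for C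
    using near_star_no_long_cycle[OF star] shortest_cycle_length(2)[OF \<Gamma>2(1) that] \<Gamma>2(3) by simp
  ultimately show ?thesis
    using G contains_from_iff[OF simple(1) \<Gamma>1(2)] contains_from_iff[OF simple(2) \<Gamma>2(2)]
    by (simp add: avoiding_def)
qed

lemma avoiding_iff_near_star:
  assumes G: "red_blue_graph G" and card: "card (verts G) = n"
  shows "avoiding \<Gamma>1 \<Gamma>2 G \<longleftrightarrow> near_star (blue_subgraph G)"
proof
  assume "avoiding \<Gamma>1 \<Gamma>2 G"
  note no = avoidingD[OF this]
  have verts: "verts (blue_subgraph G) = verts G" by (simp add: blue_subgraph_def)
  show "near_star (blue_subgraph G)"
    using large_blue_degree[OF G no(2) subset_refl card n no(1)] no(2)
    by (simp add: near_star_def degree_def nbrs_def verts card simple_colour_subgraphs(2)[OF G]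
        C4_free_iff_no_cycle)
qed (use avoiding_if_near_star[OF G] card in simp)

lemma not_avoiding_Suc:
  assumes G: "red_blue_graph G" and card: "card (verts G) = n + 1"
  shows "\<not> avoiding \<Gamma>1 \<Gamma>2 G"
proof
  assume "avoiding \<Gamma>1 \<Gamma>2 G"
  note no = avoidingD[OF this]
  let ?V = "verts G" and ?B = "\<lambda>u w. {u, w} \<in> edges (blue_subgraph G)"
  interpret C4_free ?B
    using no(2) C4_free_iff_no_cycle simple_colour_subgraphs(2)[OF G] by blast
  have fin: "finite ?V" using card n by (intro card_ge_0_finite) simp
  have large: "\<exists>v\<in>?V - {w}. n \<le> card {u \<in> ?V - {w}. ?B v u} + 2" if "w \<in> ?V" for w
    using that card by (intro large_blue_degree[OF G no(2) _ _ n no(1)]) auto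
  have "?V \<noteq> {}" using card by auto
  then obtain v where v: "v \<in> ?V" "n \<le> card {u \<in> ?V. ?B v u} + 2"
  proof -
    obtain w where "w \<in> ?V" using \<open>?V \<noteq> {}\<close> by blast
    then obtain v where v: "v \<in> ?V - {w}" "n \<le> card {u \<in> ?V - {w}. ?B v u} + 2" using large by blast
    moreover have "card {u \<in> ?V - {w}. ?B v u} \<le> card {u \<in> ?V. ?B v u}"
      using fin by (intro card_mono) auto
    ultimately have "n \<le> card {u \<in> ?V. ?B v u} + 2" by linarith
    then show thesis using v(1) that by blast
  qed
  \<comment> \<open>Deleting \<open>v\<close> forces a second vertex of large blue degree, different
    from \<open>v\<close>.\<close>
  obtain w where w: "w \<in> ?V - {v}" "n \<le> card {u \<in> ?V - {v}. ?B w u} + 2"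
    using large[OF v(1)] by blast
  \<comment> \<open>\<open>N\<close> and \<open>M\<close> avoid both \<open>v\<close> and
    \<open>w\<close>, so they lie among n - 1 vertices. Their sizes are at least n - 3 and n - 2, so
    they share at least n - 4 vertices, which is at least 2.\<close>
  define N where "N = {u \<in> ?V. ?B v u} - {w}"
  define M where "M = {u \<in> ?V - {v}. ?B w u}"
  have "card N \<ge> n - 3" using v(2) fin by (auto simp: N_def card_Diff_singleton_if)
  moreover have "N \<union> M \<subseteq> ?V - {v, w}" using irrefl by (auto simp: N_def M_def)
  then have "card (N \<union> M) \<le> n - 1"
    using card_mono[of "?V - {v, w}" "N \<union> M"] fin v(1) w(1) card
    by (auto simp: card_Diff_subset)
  moreover have "card N + card M = card (N \<union> M) + card (N \<inter> M)"
    using fin by (intro card_Un_Int) (auto simp: N_def M_def)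
  moreover have "card (N \<inter> M) \<le> card ({u \<in> ?V. ?B v u} \<inter> {u \<in> ?V. ?B w u})"
    using fin by (intro card_mono) (auto simp: N_def M_def)
  moreover have "\<dots> \<le> 1" using card_common_le_1[OF fin, of v w] w(1) by blast
  moreover have "n \<le> card M + 2" using w(2) by (simp add: M_def)
  ultimately show False using n by linarith
qed

text \<open>The witness is a blue star centred at 0. Every size up to \<open>n\<close> is treated,
  since the Ramsey number is a least element and monotonicity in the number of vertices is not
  invoked.\<close>

lemma avoiding_exists:
  assumes "0 < N" "N \<le> n"
  shows "\<exists>G :: nat rb_graph. card (verts G) = N \<and> avoiding \<Gamma>1 \<Gamma>2 G"
proof -
  define G :: "nat rb_graph" where
    "G = \<lparr>verts = {..<N}, edges = {e. e \<subseteq> {..<N} \<and> card e = 2},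
       colour = (\<lambda>e. if 0 \<in> e then Blue else Red)\<rparr>"
  have G: "red_blue_graph G"
    by (auto simp: G_def red_blue_graph_def complete_graph_def simple_graph_def)
  have E: "{u, w} \<in> edges (blue_subgraph G) \<longleftrightarrow> u < N \<and> w < N \<and> u \<noteq> w \<and> (u = 0 \<or> w = 0)" for u w
    by (auto simp: G_def blue_subgraph_def card_insert_if)
  have "C4_free (\<lambda>u w. {u, w} \<in> edges (blue_subgraph G))"
    by (rule C4_free.intro) (simp_all only: E, auto)
  moreover have "nbrs (blue_subgraph G) 0 = {0<..<N}"
    using assms(1) by (auto simp: nbrs_def E) (auto simp: G_def blue_subgraph_def)
  then have "card (verts (blue_subgraph G)) \<le> degree (blue_subgraph G) 0 + 2"
    by (simp add: degree_def G_def blue_subgraph_def)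
  ultimately have "near_star (blue_subgraph G)"
    unfolding near_star_def using simple_colour_subgraphs(2)[OF G] assms(1)
    by (intro conjI bexI[of _ 0]) (simp_all add: G_def blue_subgraph_def)
  moreover have "card (verts G) = N" by (simp add: G_def)
  ultimately show ?thesis using avoiding_if_near_star[OF G] assms(2) by auto
qed

lemma ramsey_number_eq: "ramsey_number \<Gamma>1 \<Gamma>2 = n + 1"
  unfolding ramsey_number_def
proof (rule Least_equality)
  show "n + 1 > 0 \<and> (\<forall>G :: nat rb_graph. red_blue_graph G \<and> card (verts G) = n + 1 \<longrightarrow>
      contains_from (red_subgraph G) \<Gamma>1 \<or> contains_from (blue_subgraph G) \<Gamma>2)"
    using not_avoiding_Suc by (auto simp: avoiding_def)
next
  fix N
  assume N: "N > 0 \<and> (\<forall>G :: nat rb_graph. red_blue_graph G \<and> card (verts G) = N \<longrightarrow>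
      contains_from (red_subgraph G) \<Gamma>1 \<or> contains_from (blue_subgraph G) \<Gamma>2)"
  show "n + 1 \<le> N"
    using avoiding_exists[of N] N unfolding avoiding_def by (metis Suc_eq_plus1 not_less_eq_eq)
qed

end

theorem theorem1p12:
  fixes \<Gamma>1 :: "'b graph set" and \<Gamma>2 :: "'c graph set"
    and n :: nat and G :: "'a rb_graph"
  assumes "\<Gamma>1 \<noteq> {}" and "\<forall>C\<in>\<Gamma>1. is_cycle C"
    and "\<Gamma>2 \<noteq> {}" and "\<forall>C\<in>\<Gamma>2. is_cycle C"
    and "shortest_cycle_length \<Gamma>1 = n" and "n \<ge> 6"
    and "shortest_cycle_length \<Gamma>2 = 4"
    and "red_blue_graph G"
  shows "critical \<Gamma>1 \<Gamma>2 G \<longleftrightarrow>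
    (\<exists>H \<in> \<G>1 n \<union> \<G>2 n \<union> \<G>3 n. isomorphic (blue_subgraph G) H)"
proof -
  interpret cycle_families \<Gamma>1 \<Gamma>2 n using assms by unfold_locales
  have "critical \<Gamma>1 \<Gamma>2 G \<longleftrightarrow> near_star (blue_subgraph G) \<and> card (verts G) = n"
    using avoiding_iff_near_star[OF assms(8)] by (auto simp: critical_def ramsey_number_eq)
  moreover have "card (verts (blue_subgraph G)) = card (verts G)" by (simp add: blue_subgraph_def)
  ultimately show ?thesis
    using isomorphic_\<G>_iff[OF simple_colour_subgraphs(2)[OF assms(8)], of n] assms(6) by simp
qed

end
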